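(* Let $G$ be a bipartite graph. Then $c_G(\mathfrak m)=2d$, where $d$ is the cardinality of a maximum independent set of vertices of $G$.
   Context: Let $G$ be a finite simple graph on the vertex set $[n]=\{1,\dots,n\}$, let $K$ be a field, $S=K[x_1,\dots,x_n,y_1,\dots,y_n]$ and $\mathfrak m=(x_1,\dots,x_n,y_1,\dots,y_n)$. The binomial edge ideal of $G$ is $J_G=(x_iy_j-x_jy_i : \{i,j\}\in E(G))\subset S$. For a positive integer $k$ put $\mathfrak m^{[k]}=(x_1^k,\dots,x_n^k,y_1^k,\dots,y_n^k)$, $(\mathfrak m^{[k]},J_G)=\mathfrak m^{[k]}+J_G$, $v_G(k)=\max\{r\in\mathbb N : \mathfrak m^r\not\subseteq(\mathfrak m^{[k]},J_G)\}$, and $c_G(\mathfrak m)=\lim_{k\to\infty} v_G(k)/k$ (the diagonal $F$-threshold of $S/J_G$). *)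

theory Defs
  imports Complex_Main "HOL-Library.Poly_Mapping" "HOL-Library.Set_Algebras"
begin

subsection \<open>Ideals of a commutative ring\<close>

text \<open>An ideal is a submodule of the ring acting on itself by multiplication, so
  \<^const>\<open>module.span\<close> at scalar multiplication \<open>(*)\<close> is the ideal generated by a set.\<close>

lemma module_mult_self: "module ((*) :: 'a::comm_ring_1 \<Rightarrow> 'a \<Rightarrow> 'a)"
  by unfold_locales (simp_all add: algebra_simps)

definition ideal_gen :: "'a::comm_ring_1 set \<Rightarrow> 'a set" where
  "ideal_gen B = module.span (*) B"

definition ideal_prod :: "'a::comm_ring_1 set \<Rightarrow> 'a set \<Rightarrow> 'a set" where
  "ideal_prod I J = ideal_gen {a * b | a b. a \<in> I \<and> b \<in> J}"

text \<open>The \<open>^\<close> available on sets is elementwise, hence a separate power operation.\<close>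

primrec ideal_power :: "'a::comm_ring_1 set \<Rightarrow> nat \<Rightarrow> 'a set" where
  "ideal_power I 0 = UNIV"
| "ideal_power I (Suc r) = ideal_prod I (ideal_power I r)"

subsection \<open>The polynomial ring\<close>

text \<open>The vertex set is a nonempty finite type \<open>'v\<close>. A polynomial over \<open>'k\<close> in the
  variables \<open>x\<^sub>v, y\<^sub>v\<close> maps monomials (finitely supported exponent vectors) to
  coefficients; the multiplication of \<^type>\<open>poly_mapping\<close> is convolution.\<close>

datatype 'v indet = X 'v | Y 'v

type_synonym ('v, 'k) xy_poly = "('v indet \<Rightarrow>\<^sub>0 nat) \<Rightarrow>\<^sub>0 'k"

definition Var :: "'v indet \<Rightarrow> ('v, 'k::field) xy_poly" where
  "Var t = Poly_Mapping.single (Poly_Mapping.single t 1) 1"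

definition max_ideal :: "('v, 'k::field) xy_poly set" where
  "max_ideal = ideal_gen (range Var)"

definition frob_ideal :: "nat \<Rightarrow> ('v, 'k::field) xy_poly set" where
  "frob_ideal k = ideal_gen (range (\<lambda>t. Var t ^ k))"

subsection \<open>Graphs\<close>

text \<open>A graph on the vertex set \<^term>\<open>UNIV :: 'v set\<close> is given by its set of edges.\<close>

definition simple_graph :: "'v set set \<Rightarrow> bool" where
  "simple_graph E \<longleftrightarrow> (\<forall>e\<in>E. card e = 2)"

definition bipartite :: "'v set set \<Rightarrow> bool" where
  "bipartite E \<longleftrightarrow> (\<exists>A B. A \<union> B = UNIV \<and> A \<inter> B = {} \<and> (\<forall>e\<in>E. \<exists>a\<in>A. \<exists>b\<in>B. e = {a, b}))"

definition independent_set :: "'v set set \<Rightarrow> 'v set \<Rightarrow> bool" where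
  "independent_set E A \<longleftrightarrow> (\<forall>i\<in>A. \<forall>j\<in>A. {i, j} \<notin> E)"

definition independence_number :: "'v::finite set set \<Rightarrow> nat" where
  "independence_number E = Max {card A | A. independent_set E A}"

text \<open>Each edge contributes its generator for both orderings \<open>(i, j)\<close> and \<open>(j, i)\<close>; the two
  differ only by a sign.\<close>

definition binomial_edge_ideal :: "'v set set \<Rightarrow> ('v, 'k::field) xy_poly set" where
  "binomial_edge_ideal E =
    ideal_gen {Var (X i) * Var (Y j) - Var (X j) * Var (Y i) | i j. {i, j} \<in> E}"

subsection \<open>The diagonal F-threshold\<close>

text \<open>Both notions take the ideal \<open>J\<close>, for the quotient of the polynomial ring by \<open>J\<close>;
  the graph case is \<^term>\<open>J = binomial_edge_ideal E\<close>. The sum of ideals is the elementwise sum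
  of sets. For \<open>J\<close> proper and homogeneous and \<open>k > 0\<close> the set under \<^const>\<open>Max\<close> is finite (a monomial of
  degree \<open>r > 2 n (k - 1)\<close> has an exponent \<open>\<ge> k\<close>) and contains \<open>0\<close>; the value at \<open>k = 0\<close> is
  irrelevant for the limit.\<close>

definition v_fun :: "('v::finite, 'k::field) xy_poly set \<Rightarrow> nat \<Rightarrow> nat" where
  "v_fun J k = Max {r. \<not> ideal_power max_ideal r \<subseteq> frob_ideal k + J}"

definition diag_F_threshold :: "('v::finite, 'k::field) xy_poly set \<Rightarrow> real" where
  "diag_F_threshold J = lim (\<lambda>k. real (v_fun J k) / real k)"

end

theory Submission
  imports Defs
begin

text \<open>For \<open>k > 0\<close> the value is exactly \<open>v\<^sub>G(k) = 2 d (k - 1)\<close>.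
  Lower bound: if \<open>A\<close> is independent, every monomial occurring in an element of
  \<open>\<mm>\<^sup>[\<^sup>k\<^sup>] + J\<^sub>G\<close> is divisible by some \<open>t\<^sup>k\<close> or by a variable of a vertex outside \<open>A\<close>, so the
  product of all \<open>(x\<^sub>i y\<^sub>i)\<^sup>k\<^sup>-\<^sup>1\<close> with \<open>i \<in> A\<close> is not in this ideal.
  Upper bound: by Koenig's theorem \<open>d\<close> edges and single vertices cover the vertex set. A
  monomial of degree above \<open>2 d (k - 1)\<close> has degree at least \<open>2 k - 1\<close> in the variables of one
  of these. Modulo a binomial \<open>x\<^sub>i y\<^sub>j - x\<^sub>j y\<^sub>i\<close> one can then accumulate the exponent \<open>k\<close> on
  one of the four variables, because the algebra of a single edge is a Segre product.\<close>

subsection \<open>Covering a bipartite graph by edges and vertices\<close>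

text \<open>Koenig's theorem in covering form. \<open>W\<close> and the bound \<open>k\<close> vary
  so that induction applies: at each stage one vertex or one edge is removed that meets every
  independent subset of \<open>W\<close> of size \<open>k\<close>.\<close>

lemma bipartite_cover:
  fixes E :: "'v set set"
  assumes "finite W"
    and AB: "A \<union> B = UNIV" "A \<inter> B = {}" "\<forall>e\<in>E. \<exists>a\<in>A. \<exists>b\<in>B. e = {a, b}"
    and "\<And>I. I \<subseteq> W \<Longrightarrow> independent_set E I \<Longrightarrow> card I \<le> k"
  shows "\<exists>P. finite P \<and> card P \<le> k \<and> W \<subseteq> \<Union>P \<and> (\<forall>p\<in>P. (\<exists>v. p = {v}) \<or> p \<in> E)"
  using assms(1,5)
proof (induction W arbitrary: k rule: finite_psubset_induct)
  case (psubset W)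
  have edge: "(x \<in> A \<and> y \<in> B) \<or> (x \<in> B \<and> y \<in> A)" if "{x, y} \<in> E" for x y
    using AB(3) that by (metis doubleton_eq_iff)
  show ?case
  proof (cases "W \<inter> A = {}")
    case True
    then have "independent_set E W"
      unfolding independent_set_def using edge by blast
    then have "card W \<le> k" using psubset.prems by blast
    then have "card ((\<lambda>v. {v}) ` W) \<le> k"
      using card_image_le[OF psubset.hyps(1)] le_trans by blast
    then show ?thesis
      using psubset.hyps(1) by (intro exI[of _ "(\<lambda>v. {v}) ` W"]) auto
  next
    case False
    then obtain a where a: "a \<in> W" "a \<in> A" by blast
    \<comment> \<open>This yields \<open>k \<ge> 1\<close>, so the truncated \<open>k - 1\<close>
      below really is one less than \<open>k\<close>.\<close>
    have "independent_set E {a}"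
      using edge[of a a] AB(2) a by (auto simp: independent_set_def)
    then have "card {a} \<le> k" using psubset.prems a by blast
    then have k: "k \<ge> 1" by simp
    have extend: ?thesis if e: "(\<exists>v. e = {v}) \<or> e \<in> E" and a_in: "a \<in> e"
      and less: "\<And>I. I \<subseteq> W - e \<Longrightarrow> independent_set E I \<Longrightarrow> card I \<le> k - 1" for e
    proof -
      have "W - e \<subset> W" using a a_in by blast
      from psubset.IH[OF this less] obtain P where
        P: "finite P" "card P \<le> k - 1" "W - e \<subseteq> \<Union>P" "\<forall>p\<in>P. (\<exists>v. p = {v}) \<or> p \<in> E"
        by blast
      have "card (insert e P) \<le> k"
        using card_insert_le_m1[of k P e] P(2) k by simp
      then show ?thesis using P e by (intro exI[of _ "insert e P"]) auto
    qed
    \<comment> \<open>The independent subsets of \<open>W\<close> that attain the bound while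
      avoiding \<open>a\<close>.\<close>
    define Q where "Q S \<longleftrightarrow> S \<subseteq> W - {a} \<and> independent_set E S \<and> card S = k" for S
    show ?thesis
    proof (cases "\<exists>S. Q S")
      case False
      \<comment> \<open>Every independent set of size \<open>k\<close> contains \<open>a\<close>, so
        deleting \<open>a\<close> alone lowers the bound.\<close>
      show ?thesis
      proof (rule extend[of "{a}"])
        fix I assume I: "I \<subseteq> W - {a}" "independent_set E I"
        then have "card I \<le> k" using psubset.prems by blast
        moreover have "card I \<noteq> k" using False I by (auto simp: Q_def)
        ultimately show "card I \<le> k - 1" by linarith
      qed auto
    next
      case True
      then obtain S where S: "Q S" and S_min: "\<And>T. Q T \<Longrightarrow> card (S \<inter> B) \<le> card (T \<inter> B)"
        using ex_has_least_nat[of Q _ "\<lambda>T. card (T \<inter> B)"] by blast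
      have fin: "finite T" if "Q T" for T
        using that psubset.hyps(1) finite_subset by (auto simp: Q_def)
      \<comment> \<open>Adding \<open>a\<close> to \<open>S\<close> would give \<open>k + 1\<close>
        independent vertices; hence \<open>a\<close> has a neighbour \<open>b\<close> in
        \<open>S\<close>.\<close>
      have "\<not> independent_set E (insert a S)"
      proof
        assume "independent_set E (insert a S)"
        moreover have "insert a S \<subseteq> W" using S a by (auto simp: Q_def)
        ultimately have "card (insert a S) \<le> k" using psubset.prems by blast
        then show False using S fin[OF S] by (auto simp: Q_def card_insert_if split: if_splits)
      qed
      then obtain b where b: "b \<in> S" "{a, b} \<in> E"
        using S edge[of a a] AB(2) a
        by (auto simp: independent_set_def Q_def insert_commute)
      have bB: "b \<in> B" using edge[OF b(2)] a AB(2) by blast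
      \<comment> \<open>Independent sets form a lattice under union on one side and intersection on the other;
         meet and join of two maximum ones are again maximum, so the minimal \<open>S \<inter> B\<close> lies in
         every maximum one.\<close>
      have b_in: "b \<in> T" if T: "Q T" for T
      proof (rule ccontr)
        assume "b \<notin> T"
        define U where "U = (S \<union> T) \<inter> A \<union> (S \<inter> T) \<inter> B"
        define L where "L = (S \<inter> T) \<inter> A \<union> (S \<union> T) \<inter> B"
        have ind: "independent_set E U" "independent_set E L"
          using S T edge AB(2) unfolding U_def L_def Q_def independent_set_def by blast+
        have sub: "U \<subseteq> W - {a}" "L \<subseteq> W - {a}"
          using S T by (auto simp: U_def L_def Q_def)
        have "U \<union> L = S \<union> T" "U \<inter> L = S \<inter> T"
          using AB(1,2) by (auto simp: U_def L_def)
        moreover have "finite U" "finite L"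
          using sub psubset.hyps(1) finite_subset by blast+
        ultimately have "card U + card L = card S + card T"
          using fin[OF S] fin[OF T] by (metis card_Un_Int)
        moreover have "card U \<le> k" "card L \<le> k"
          using psubset.prems ind sub by blast+
        \<comment> \<open>The two cardinalities add up to \<open>2 * k\<close> and neither exceeds
          \<open>k\<close>, so both equal \<open>k\<close>.\<close>
        ultimately have "Q U" using S T ind sub by (auto simp: Q_def)
        moreover have "U \<inter> B \<subset> S \<inter> B"
          using AB(2) \<open>b \<notin> T\<close> b(1) bB by (auto simp: U_def)
        then have "card (U \<inter> B) < card (S \<inter> B)"
          using fin[OF S] by (simp add: psubset_card_mono)
        ultimately show False using S_min by fastforce
      qed
      \<comment> \<open>An independent set of size \<open>k\<close> contains \<open>a\<close>, or
        else it satisfies \<open>Q\<close> and contains \<open>b\<close>; the edge meets it in both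
        cases.\<close>
      show ?thesis
      proof (rule extend[of "{a, b}"])
        fix I assume I: "I \<subseteq> W - {a, b}" "independent_set E I"
        then have "card I \<le> k" using psubset.prems by blast
        moreover have "card I \<noteq> k" using b_in[of I] I by (auto simp: Q_def)
        ultimately show "card I \<le> k - 1" by linarith
      qed (use b in auto)
    qed
  qed
qed

lemma independence_number_Max:
  fixes E :: "'v::finite set set"
  shows "\<exists>A. independent_set E A \<and> card A = independence_number E"
    and "independent_set E I \<Longrightarrow> card I \<le> independence_number E"
proof -
  let ?C = "{card A | A. independent_set E A}"
  have fin: "finite ?C" by simp
  have "independent_set E {}" by (simp add: independent_set_def)
  then have "?C \<noteq> {}" by blast
  from Max_in[OF fin this] show "\<exists>A. independent_set E A \<and> card A = independence_number E"
    by (auto simp: independence_number_def)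
  show "independent_set E I \<Longrightarrow> card I \<le> independence_number E"
    unfolding independence_number_def by (intro Max_ge[OF fin]) blast
qed

subsection \<open>Ideals\<close>

interpretation ideal: module "(*) :: 'a::comm_ring_1 \<Rightarrow> 'a \<Rightarrow> 'a"
  by (rule module_mult_self)

abbreviation is_ideal :: "'a::comm_ring_1 set \<Rightarrow> bool" where
  "is_ideal \<equiv> ideal.subspace"

lemma is_ideal_ideal_gen: "is_ideal (ideal_gen B)"
  unfolding ideal_gen_def by (rule ideal.subspace_span)

lemma ideal_gen_superset: "x \<in> B \<Longrightarrow> x \<in> ideal_gen B"
  unfolding ideal_gen_def by (rule ideal.span_base)

lemma ideal_gen_minimal: "B \<subseteq> I \<Longrightarrow> is_ideal I \<Longrightarrow> ideal_gen B \<subseteq> I"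
  unfolding ideal_gen_def by (rule ideal.span_minimal)

lemma is_ideal_set_plus: "is_ideal I \<Longrightarrow> is_ideal J \<Longrightarrow> is_ideal (I + J)"
proof (rule ideal.subspaceI)
  assume I: "is_ideal I" and J: "is_ideal J"
  show "0 \<in> I + J"
    using set_plus_intro[OF ideal.subspace_0[OF I] ideal.subspace_0[OF J]] by simp
  show "x + y \<in> I + J" if xy: "x \<in> I + J" "y \<in> I + J" for x y
  proof -
    obtain a b c d where "x = a + b" "y = c + d" "a \<in> I" "b \<in> J" "c \<in> I" "d \<in> J"
      using xy unfolding set_plus_def by blast
    moreover have "(a + b) + (c + d) = (a + c) + (b + d)" by (simp add: ac_simps)
    ultimately show ?thesis
      using set_plus_intro[OF ideal.subspace_add[OF I] ideal.subspace_add[OF J]] by metis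
  qed
  show "c * x \<in> I + J" if x: "x \<in> I + J" for c x
  proof -
    obtain a b where "x = a + b" "a \<in> I" "b \<in> J"
      using x unfolding set_plus_def by blast
    then show ?thesis
      using set_plus_intro[OF ideal.subspace_scale[OF I] ideal.subspace_scale[OF J]]
      by (simp add: distrib_left)
  qed
qed

lemma is_ideal_set_plus_supset:
  assumes "is_ideal I" "is_ideal J"
  shows "I \<subseteq> I + J" "J \<subseteq> I + J"
  using set_plus_intro[of _ I 0 J] set_plus_intro[of 0 I _ J]
    ideal.subspace_0[OF assms(1)] ideal.subspace_0[OF assms(2)] by auto

subsection \<open>Monomials\<close>

abbreviation lookup :: "('a \<Rightarrow>\<^sub>0 'b::zero) \<Rightarrow> 'a \<Rightarrow> 'b" where
  "lookup \<equiv> Poly_Mapping.lookup"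

abbreviation keys :: "('a \<Rightarrow>\<^sub>0 'b::zero) \<Rightarrow> 'a set" where
  "keys \<equiv> Poly_Mapping.keys"

lemma UNIV_indet: "(UNIV :: 'v indet set) = range X \<union> range Y"
proof -
  have "t \<in> range X \<union> range Y" for t :: "'v indet" by (cases t) auto
  then show ?thesis by blast
qed

lemma finite_UNIV_indet [simp]: "finite (UNIV :: 'v::finite indet set)"
  by (simp add: UNIV_indet)

definition mono_deg :: "('v::finite indet \<Rightarrow>\<^sub>0 nat) \<Rightarrow> nat" where
  "mono_deg m = (\<Sum>t\<in>UNIV. lookup m t)"

lemma mono_deg_add: "mono_deg (m + m') = mono_deg m + mono_deg m'"
  by (simp add: mono_deg_def lookup_add sum.distrib)

lemma mono_deg_single [simp]: "mono_deg (Poly_Mapping.single t c) = c"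
  by (simp add: mono_deg_def lookup_single when_def)

text \<open>Grouping the degree by vertices lets it be compared with a cover of the vertex
  set.\<close>

lemma mono_deg_vertices:
  "mono_deg m = (\<Sum>v\<in>UNIV. lookup m (X v) + lookup m (Y v))"
proof -
  have "mono_deg m = sum (lookup m) (range X) + sum (lookup m) (range Y)"
    unfolding mono_deg_def UNIV_indet by (rule sum.union_disjoint) auto
  then show ?thesis
    by (simp add: sum.reindex inj_def sum.distrib)
qed

lemma monomial_factor:
  fixes m :: "'a \<Rightarrow>\<^sub>0 nat"
  assumes "c \<le> lookup m t"
  shows "(m - Poly_Mapping.single t c) + Poly_Mapping.single t c = m"
proof (rule poly_mapping_eqI)
  fix s
  show "lookup (m - Poly_Mapping.single t c + Poly_Mapping.single t c) s = lookup m s"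
    using assms by (cases "s = t") (simp_all add: lookup_add lookup_minus lookup_single)
qed

lemma Var_power: "Var t ^ c = Poly_Mapping.single (Poly_Mapping.single t c) 1"
  by (induction c) (simp_all add: Var_def mult_single single_add[symmetric])

text \<open>Monomial ideals, given by a condition on exponents that survives multiplication. They
  bound other ideals from above: powers of \<open>max_ideal\<close> by degree, and
  \<open>frob_edge_ideal\<close> by the predicate \<open>bad\<close>.\<close>

lemma is_ideal_keys:
  assumes "\<And>m m'. P m \<Longrightarrow> P (m' + m)"
  shows "is_ideal {p :: ('v, 'k::field) xy_poly. \<forall>m\<in>keys p. P m}"
proof (rule ideal.subspaceI)
  fix p q :: "('v, 'k) xy_poly"
  assume "p \<in> {p. \<forall>m\<in>keys p. P m}" "q \<in> {p. \<forall>m\<in>keys p. P m}"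
  then show "p + q \<in> {p. \<forall>m\<in>keys p. P m}"
    using keys_add[of p q] by blast
next
  fix c p :: "('v, 'k) xy_poly"
  assume "p \<in> {p. \<forall>m\<in>keys p. P m}"
  then show "c * p \<in> {p. \<forall>m\<in>keys p. P m}"
    using keys_mult[of c p] assms by blast
qed simp

text \<open>A polynomial is the sum of its terms, and each term is a constant times a monomial. This
  reduces the upper bound to monomials.\<close>

lemma keys_imp_mem_ideal:
  fixes p :: "('v, 'k::field) xy_poly"
  assumes "is_ideal I" and "\<And>m. m \<in> keys p \<Longrightarrow> Poly_Mapping.single m 1 \<in> I"
  shows "p \<in> I"
proof -
  have "Poly_Mapping.single m (lookup p m) \<in> I" if "m \<in> keys p" for m
  proof -
    have "Poly_Mapping.single m (lookup p m)
        = Poly_Mapping.single 0 (lookup p m) * Poly_Mapping.single m 1"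
      by (simp add: mult_single)
    then show ?thesis
      using ideal.subspace_scale[OF assms(1) assms(2)[OF that]] by metis
  qed
  then have "(\<Sum>m\<in>keys p. Poly_Mapping.single m (lookup p m)) \<in> I"
    by (intro ideal.subspace_sum[OF assms(1)]) auto
  moreover have "(\<Sum>m\<in>keys p. Poly_Mapping.single m (lookup p m)) = p"
    by (intro poly_mapping_eqI) (simp add: lookup_sum lookup_single when_def in_keys_iff)
  ultimately show ?thesis by simp
qed

lemma single_mem_ideal_if_power_mem:
  assumes "is_ideal I" "Var t ^ c \<in> I" "c \<le> lookup m t"
  shows "(Poly_Mapping.single m 1 :: ('v, 'k::field) xy_poly) \<in> I"
proof -
  have "Poly_Mapping.single m 1
      = Poly_Mapping.single (m - Poly_Mapping.single t c) 1 * (Var t ^ c :: ('v, 'k) xy_poly)"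
    by (simp add: Var_power mult_single monomial_factor[OF assms(3)])
  then show ?thesis using ideal.subspace_scale[OF assms(1,2)] by metis
qed

lemma ideal_power_max_ideal_keys:
  "ideal_power max_ideal r \<subseteq> {p :: ('v::finite, 'k::field) xy_poly. \<forall>m\<in>keys p. r \<le> mono_deg m}"
proof (induction r)
  case (Suc r)
  have deg: "is_ideal {p :: ('v, 'k) xy_poly. \<forall>m\<in>keys p. s \<le> mono_deg m}" for s
    by (rule is_ideal_keys) (simp add: mono_deg_add)
  have "max_ideal \<subseteq> {p :: ('v, 'k) xy_poly. \<forall>m\<in>keys p. 1 \<le> mono_deg m}"
    unfolding max_ideal_def by (rule ideal_gen_minimal[OF _ deg]) (auto simp: Var_def)
  then have "\<forall>m\<in>keys (a * b). Suc r \<le> mono_deg m"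
    if "a \<in> max_ideal" "b \<in> ideal_power max_ideal r" for a b :: "('v, 'k) xy_poly"
    using keys_mult[of a b] that Suc by (fastforce simp: mono_deg_add)
  then show ?case
    unfolding ideal_power.simps ideal_prod_def by (intro ideal_gen_minimal[OF _ deg]) blast
qed simp

lemma single_mem_ideal_power:
  "mono_deg m = r \<Longrightarrow> (Poly_Mapping.single m 1 :: ('v::finite, 'k::field) xy_poly) \<in> ideal_power max_ideal r"
proof (induction r arbitrary: m)
  case (Suc r)
  then have "(\<Sum>t\<in>UNIV. lookup m t) \<noteq> 0" by (simp add: mono_deg_def)
  then obtain t where "lookup m t \<noteq> 0" by (meson sum.neutral)
  then have "1 \<le> lookup m t" by simp
  from monomial_factor[OF this] obtain m' where m: "m = m' + Poly_Mapping.single t 1"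
    by metis
  have "mono_deg m' = r"
    using Suc.prems by (simp add: m mono_deg_add)
  then have "(Poly_Mapping.single m' 1 :: ('v, 'k) xy_poly) \<in> ideal_power max_ideal r"
    by (rule Suc.IH)
  moreover have "(Var t :: ('v, 'k) xy_poly) \<in> max_ideal"
    unfolding max_ideal_def by (rule ideal_gen_superset) simp
  moreover have "Poly_Mapping.single m 1 = Var t * (Poly_Mapping.single m' 1 :: ('v, 'k) xy_poly)"
    by (simp add: m Var_def mult_single add.commute)
  ultimately show ?case
    unfolding ideal_power.simps ideal_prod_def by (intro ideal_gen_superset) blast
qed simp

subsection \<open>The value of \<open>v\<^sub>G\<close>\<close>

text \<open>Modulo the binomial, a factor \<open>r s\<close> may be traded for \<open>p q\<close>.
  While the exponent of \<open>p\<close> is below \<open>k\<close>, the two bounds force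
  \<open>r\<close> and \<open>s\<close> to occur; a trade raises that exponent and preserves both
  bounds, so it eventually reaches \<open>k\<close>.\<close>

lemma single_mem_ideal_if_binomial_mem:
  fixes I :: "('v, 'k::field) xy_poly set"
  assumes "is_ideal I" and "Var p ^ k \<in> I" and "Var p * Var q - Var r * Var s \<in> I"
    and "p \<noteq> r" "p \<noteq> s" "r \<noteq> s"
    and "k \<le> lookup m p + lookup m r" "k \<le> lookup m p + lookup m s"
  shows "Poly_Mapping.single m 1 \<in> I"
  using assms(7,8)
proof (induction "k - lookup m p" arbitrary: m rule: less_induct)
  case less
  show ?case
  proof (cases "k \<le> lookup m p")
    case True
    then show ?thesis by (intro single_mem_ideal_if_power_mem[OF assms(1,2)])
  next
    case False
    define e where "e t = Poly_Mapping.single t (1 :: nat)" for t :: "'v indet"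
    define m0 where "m0 = m - e r - e s"
    define m' where "m' = m0 + e p + e q"
    \<comment> \<open>Both exponents are positive and \<open>r \<noteq> s\<close>, so the truncated
      subtractions in \<open>m0\<close> lose nothing.\<close>
    have m: "m = m0 + e r + e s"
      using less.prems False assms(6)
      by (intro poly_mapping_eqI)
        (auto simp: m0_def e_def lookup_add lookup_minus lookup_single when_def)
    have "lookup m p < lookup m' p"
      "lookup m p + lookup m r \<le> lookup m' p + lookup m' r"
      "lookup m p + lookup m s \<le> lookup m' p + lookup m' s"
      using assms(4-6) by (auto simp: m m'_def e_def lookup_add lookup_single when_def)
    then have "Poly_Mapping.single m' 1 \<in> I"
      using less.prems False by (intro less.hyps) linarith+
    moreover have "Poly_Mapping.single m 1 = Poly_Mapping.single m' 1
        - Poly_Mapping.single m0 1 * (Var p * Var q - Var r * Var s :: ('v, 'k) xy_poly)"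
      by (simp add: m m'_def Var_def mult_single right_diff_distrib e_def add.assoc)
    ultimately show ?thesis
      using ideal.subspace_diff[OF assms(1) _ ideal.subspace_scale[OF assms(1,3)]] by simp
  qed
qed

section \<open>Frobenius power plus binomial edge ideal\<close>

abbreviation frob_edge_ideal :: "'v set set \<Rightarrow> nat \<Rightarrow> ('v, 'k::field) xy_poly set" where
  "frob_edge_ideal E k \<equiv> frob_ideal k + binomial_edge_ideal E"

lemma is_ideal_frob_edge_ideal: "is_ideal (frob_edge_ideal E k)"
  unfolding frob_ideal_def binomial_edge_ideal_def
  by (intro is_ideal_set_plus is_ideal_ideal_gen)

lemma Var_power_mem_frob_edge_ideal: "Var t ^ k \<in> frob_edge_ideal E k"
  unfolding frob_ideal_def binomial_edge_ideal_def
  by (rule subsetD[OF is_ideal_set_plus_supset(1)[OF is_ideal_ideal_gen is_ideal_ideal_gen]])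
    (intro ideal_gen_superset rangeI)

lemma binomial_mem_frob_edge_ideal:
  assumes "{i, j} \<in> E"
  shows "Var (X i) * Var (Y j) - Var (X j) * Var (Y i) \<in> frob_edge_ideal E k"
proof -
  have "Var (X i) * Var (Y j) - Var (X j) * Var (Y i) \<in> binomial_edge_ideal E"
    unfolding binomial_edge_ideal_def using assms by (intro ideal_gen_superset) blast
  then show ?thesis
    using is_ideal_set_plus_supset(2)[OF is_ideal_ideal_gen is_ideal_ideal_gen]
    by (auto simp: frob_ideal_def binomial_edge_ideal_def)
qed

text \<open>Arrange the four exponents in a square with rows \<open>X\<close>, \<open>Y\<close> and
  columns \<open>i\<close>, \<open>j\<close>. As the total is at least \<open>2 * k - 1\<close>,
  some row and some column each sum to at least \<open>k\<close>; the variable where they cross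
  serves as \<open>p\<close>, its neighbours as \<open>r\<close> and \<open>s\<close>.\<close>

lemma single_mem_frob_edge_ideal_if_edge:
  assumes "{i, j} \<in> E" "i \<noteq> j"
    and "2 * k - 1 \<le> lookup m (X i) + lookup m (Y i) + (lookup m (X j) + lookup m (Y j))"
  shows "(Poly_Mapping.single m 1 :: ('v, 'k::field) xy_poly) \<in> frob_edge_ideal E k"
proof -
  have ji: "{j, i} \<in> E" using assms(1) by (simp add: insert_commute)
  note move = single_mem_ideal_if_binomial_mem[OF is_ideal_frob_edge_ideal
      Var_power_mem_frob_edge_ideal]
  note ij = binomial_mem_frob_edge_ideal[OF assms(1)] and ji = binomial_mem_frob_edge_ideal[OF ji]
  \<comment> \<open>Commuting the factors puts a \<open>Y\<close> variable first, in the position of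
    \<open>p\<close>.\<close>
  note ij' = ij[unfolded mult.commute[of "Var (X _)"]] and ji' = ji[unfolded mult.commute[of "Var (X _)"]]
  consider
      "k \<le> lookup m (X i) + lookup m (X j)" "k \<le> lookup m (X i) + lookup m (Y i)"
    | "k \<le> lookup m (X j) + lookup m (X i)" "k \<le> lookup m (X j) + lookup m (Y j)"
    | "k \<le> lookup m (Y i) + lookup m (Y j)" "k \<le> lookup m (Y i) + lookup m (X i)"
    | "k \<le> lookup m (Y j) + lookup m (Y i)" "k \<le> lookup m (Y j) + lookup m (X j)"
    using assms(3) by linarith
  then show ?thesis
  proof cases
    case 1
    then show ?thesis using assms(2) by (intro move[OF ij]) auto
  next
    case 2
    then show ?thesis using assms(2) by (intro move[OF ji]) auto
  next
    case 3
    then show ?thesis using assms(2) by (intro move[OF ji']) auto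
  next
    case 4
    then show ?thesis using assms(2) by (intro move[OF ij']) auto
  qed
qed

section \<open>Upper bound\<close>

lemma ideal_power_subset_frob_edge_ideal:
  fixes E :: "'v::finite set set"
  assumes "simple_graph E" "bipartite E" "k > 0" "2 * independence_number E * (k - 1) < r"
  shows "ideal_power max_ideal r \<subseteq> (frob_edge_ideal E k :: ('v, 'k::field) xy_poly set)"
proof
  fix p :: "('v, 'k) xy_poly"
  assume "p \<in> ideal_power max_ideal r"
  then have deg: "r \<le> mono_deg m" if "m \<in> keys p" for m
    using ideal_power_max_ideal_keys that by blast
  obtain A B where AB: "A \<union> B = UNIV" "A \<inter> B = {}" "\<forall>e\<in>E. \<exists>a\<in>A. \<exists>b\<in>B. e = {a, b}"
    using assms(2) unfolding bipartite_def by blast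
  obtain P where P: "finite P" "card P \<le> independence_number E" "UNIV \<subseteq> \<Union>P"
      "\<forall>p\<in>P. (\<exists>v. p = {v}) \<or> p \<in> E"
    using bipartite_cover[OF finite[of UNIV] AB, of "independence_number E"]
      independence_number_Max(2)[of E] by auto
  have "Poly_Mapping.single m 1 \<in> (frob_edge_ideal E k :: ('v, 'k) xy_poly set)"
    if m: "m \<in> keys p" for m
  proof -
    define w where "w v = lookup m (X v) + lookup m (Y v)" for v
    \<comment> \<open>Pigeonhole: if each piece of the cover carried at most
      \<open>2 * (k - 1)\<close>, the degree of \<open>m\<close> would be below
      \<open>r\<close>.\<close>
    have "\<exists>e\<in>P. 2 * (k - 1) < sum w e"
    proof (rule ccontr)
      assume "\<not> (\<exists>e\<in>P. 2 * (k - 1) < sum w e)"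
      then have "(\<Sum>e\<in>P. sum w e) \<le> card P * (2 * (k - 1))"
        using sum_bounded_above[of P "sum w" "2 * (k - 1)"] by (auto simp: not_less)
      also have "\<dots> \<le> independence_number E * (2 * (k - 1))"
        using P(2) by (rule mult_le_mono1)
      also have "\<dots> < r"
        using assms(4) by (simp add: ac_simps)
      also have "r \<le> mono_deg m"
        by (rule deg[OF m])
      also have "mono_deg m = sum w (\<Union>P)"
        using P(3) by (simp add: mono_deg_vertices w_def top.extremum_unique)
      \<comment> \<open>Only an inequality, since the pieces may overlap.\<close>
      also have "\<dots> \<le> (\<Sum>e\<in>P. sum w e)"
        using P(1)
      proof (induction P rule: finite_induct)
        case (insert e P)
        have "sum w (e \<union> \<Union>P) \<le> sum w e + sum w (\<Union>P)"
          using sum_Un_nat[of e "\<Union>P" w] by simp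
        then show ?case using insert by simp
      qed simp
      finally show False by simp
    qed
    then obtain e where e: "e \<in> P" "2 * (k - 1) < sum w e" by blast
    consider v where "e = {v}" | "e \<in> E" using P(4) e(1) by blast
    then show ?thesis
    proof cases
      case 1
      \<comment> \<open>Two exponents of at most \<open>k - 1\<close> would sum to at most
        \<open>2 * (k - 1)\<close>.\<close>
      then have "k \<le> lookup m (X v) \<or> k \<le> lookup m (Y v)"
        using e(2) by (auto simp: w_def)
      then show ?thesis
        using single_mem_ideal_if_power_mem[OF is_ideal_frob_edge_ideal
            Var_power_mem_frob_edge_ideal] by blast
    next
      case 2
      then obtain i j where ij: "e = {i, j}" "i \<noteq> j"
        using assms(1) unfolding simple_graph_def by (meson card_2_iff)
      then show ?thesis
        using 2 e(2) assms(3) by (intro single_mem_frob_edge_ideal_if_edge) (auto simp: w_def)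
    qed
  qed
  then show "p \<in> frob_edge_ideal E k"
    by (rule keys_imp_mem_ideal[OF is_ideal_frob_edge_ideal])
qed

section \<open>Lower bound\<close>

lemma ideal_power_not_subset_frob_edge_ideal:
  fixes E :: "'v::finite set set"
  assumes "independent_set E A" "k > 0"
  shows "\<not> ideal_power max_ideal (2 * card A * (k - 1))
    \<subseteq> (frob_edge_ideal E k :: ('v, 'k::field) xy_poly set)"
proof -
  define bad where "bad m \<longleftrightarrow> (\<exists>t. k \<le> lookup m t)
    \<or> (\<exists>v. v \<notin> A \<and> (0 < lookup m (X v) \<or> 0 < lookup m (Y v)))" for m :: "'v indet \<Rightarrow>\<^sub>0 nat"
  let ?bad = "{p :: ('v, 'k) xy_poly. \<forall>m\<in>keys p. bad m}"
  have ideal: "is_ideal ?bad"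
    by (rule is_ideal_keys) (auto simp: bad_def lookup_add intro: trans_le_add2)
  have frob: "frob_ideal k \<subseteq> ?bad"
    unfolding frob_ideal_def
    by (rule ideal_gen_minimal[OF _ ideal]) (auto simp: Var_power bad_def lookup_single when_def)
  have "Var (X i) * Var (Y j) - Var (X j) * Var (Y i) \<in> ?bad" if "{i, j} \<in> E" for i j
  proof -
    \<comment> \<open>Both terms of the binomial involve a variable of each end, so one end outside
      \<open>A\<close> makes both \<open>bad\<close>.\<close>
    have "i \<notin> A \<or> j \<notin> A"
      using assms(1) that by (auto simp: independent_set_def)
    then have "Var (X i) * Var (Y j) \<in> ?bad" "Var (X j) * Var (Y i) \<in> ?bad"
      by (auto simp: Var_def mult_single bad_def lookup_add lookup_single when_def)
    then show ?thesis by (rule ideal.subspace_diff[OF ideal])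
  qed
  then have "binomial_edge_ideal E \<subseteq> ?bad"
    unfolding binomial_edge_ideal_def by (intro ideal_gen_minimal[OF _ ideal]) blast
  with frob have sub: "frob_edge_ideal E k \<subseteq> ?bad"
    using ideal.subspace_add[OF ideal] by (blast elim: set_plus_elim)
  \<comment> \<open>The largest monomial that is not \<open>bad\<close>: exponent
    \<open>k - 1\<close> at both variables of each vertex of \<open>A\<close>, and 0
    elsewhere.\<close>
  define f where "f t = (case t of X v \<Rightarrow> if v \<in> A then k - 1 else 0 | Y v \<Rightarrow> if v \<in> A then k - 1 else 0)"
    for t
  define m where "m = Abs_poly_mapping f"
  have lookup_m: "lookup m = f"
    unfolding m_def by (simp add: Abs_poly_mapping_inverse finite_subset[OF subset_UNIV finite_UNIV_indet])
  have "mono_deg m = (\<Sum>v\<in>UNIV. if v \<in> A then 2 * (k - 1) else 0)"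
    unfolding mono_deg_vertices by (intro sum.cong) (auto simp: lookup_m f_def)
  also have "\<dots> = 2 * card A * (k - 1)"
    by (simp add: sum.If_cases)
  finally have "(Poly_Mapping.single m 1 :: ('v, 'k) xy_poly) \<in> ideal_power max_ideal (2 * card A * (k - 1))"
    by (rule single_mem_ideal_power)
  moreover have "\<not> bad m"
    using assms(2) by (auto simp: bad_def lookup_m f_def split: indet.splits)
  then have "Poly_Mapping.single m 1 \<notin> ?bad" by simp
  ultimately show ?thesis using sub by blast
qed

section \<open>Exact value and limit\<close>

lemma v_fun_binomial_edge_ideal:
  fixes E :: "'v::finite set set"
  assumes "simple_graph E" "bipartite E" "k > 0"
  shows "v_fun (binomial_edge_ideal E :: ('v, 'k::field) xy_poly set) k
    = 2 * independence_number E * (k - 1)"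
proof -
  let ?R = "{r. \<not> ideal_power max_ideal r \<subseteq> (frob_edge_ideal E k :: ('v, 'k) xy_poly set)}"
  have le: "r \<le> 2 * independence_number E * (k - 1)" if "r \<in> ?R" for r
    using ideal_power_subset_frob_edge_ideal[OF assms, of r] that by (auto simp: not_less[symmetric])
  \<comment> \<open>Finiteness ensures that \<open>Max\<close> is a genuine maximum.\<close>
  then have "finite ?R" by (meson finite_nat_set_iff_bounded_le)
  moreover obtain A where "independent_set E A" "card A = independence_number E"
    using independence_number_Max(1) by blast
  then have "2 * independence_number E * (k - 1) \<in> ?R"
    using ideal_power_not_subset_frob_edge_ideal[of E A k] assms(3) by auto
  ultimately show ?thesis
    unfolding v_fun_def using le by (intro Max_eqI)
qed

theorem theorem3p5:
  fixes E :: "'v::finite set set"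
  assumes "simple_graph E" and "bipartite E"
  shows "convergent (\<lambda>k. real (v_fun (binomial_edge_ideal E :: ('v, 'k::field) xy_poly set) k) / real k)
    \<and> diag_F_threshold (binomial_edge_ideal E :: ('v, 'k) xy_poly set)
        = 2 * real (independence_number E)"
proof -
  let ?d = "2 * real (independence_number E)"
  let ?v = "\<lambda>k. real (v_fun (binomial_edge_ideal E :: ('v, 'k) xy_poly set) k) / real k"
  have "(\<lambda>k. ?d - ?d / real k) \<longlonglongrightarrow> ?d - 0"
    by (intro tendsto_diff tendsto_const lim_const_over_n)
  moreover have "\<forall>\<^sub>F k in sequentially. ?d - ?d / real k = ?v k"
    using eventually_gt_at_top[of 0]
  proof eventually_elim
    case (elim k)
    have "?v k = ?d * (real k - 1) / real k"
      using elim by (simp add: v_fun_binomial_edge_ideal[OF assms elim] of_nat_diff)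
    then show ?case
      using elim by (simp add: right_diff_distrib diff_divide_distrib)
  qed
  ultimately have "?v \<longlonglongrightarrow> ?d - 0"
    by (rule Lim_transform_eventually)
  then have "?v \<longlonglongrightarrow> ?d"
    by simp
  then show ?thesis
    unfolding diag_F_threshold_def by (intro conjI convergentI limI)
qed

end
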